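(* Let $\mathcal{L}\subseteq\mathbb{Z}^n$ be a lattice (subgroup) of rank $m$ and let $c\in\mathbb{Q}^n$ be a cost vector such that the lattice programs for $\mathcal{L}$ and $c$ are bounded. Then the lattice programming gap $\mathrm{gap}(\mathcal{L},c)$ equals the maximum, over all irreducible components $I(u,\tau)$ of the monomial ideal $M(\mathcal{L},c)$, of the gap value of $I(u,\tau)$ with respect to $\mathcal{L}$ and $c$.
   Context: Let $\mathcal{L}_{\mathbb{R}}=\mathcal{L}\otimes_{\mathbb{Z}}\mathbb{R}\subseteq\mathbb{R}^n$ be the real span of $\mathcal{L}$ and $\mathbb{N}=\{0,1,2,\dots\}$. For $z\in\mathbb{N}^n$, the lattice program is: minimize $c\cdot v$ subject to $v\equiv z \bmod \mathcal{L}$, $v\in\mathbb{N}^n$. Its linear relaxation is: minimize $c\cdot v$ subject to $v\equiv z\bmod \mathcal{L}_{\mathbb{R}}$, $v\in\mathbb{R}^n$, $v\ge 0$. $\mathrm{gap}(\mathcal{L},c)$ is the maximum of (optimal value of the lattice program) $-$ (optimal value of its linear relaxation) as $z$ runs over $\mathbb{N}^n$. $M(\mathcal{L},c)$ is the ideal of $\mathbb{R}[x_1,\dots,x_n]$ generated by all monomials $x^u$, $u\in\mathbb{N}^n$, such that $u$ is not an optimal solution of the lattice program with $z=u$. For $\tau=\{i_1,\dots,i_r\}\subseteq\{1,\dots,n\}$ and $u\in\mathbb{N}^n$ with $u_j=0$ for $j\notin\tau$, put $I(u,\tau)=\langle x_{i_1}^{u_{i_1}+1},\dots,x_{i_r}^{u_{i_r}+1}\rangle$.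 Monomial ideals generated by powers of variables are called irreducible; every monomial ideal is uniquely an irredundant intersection of finitely many irreducible monomial ideals, called its irreducible components. The gap value of $I(u,\tau)$ with respect to $\mathcal{L}$ and $c$ is the optimal value of the linear program in $v\in\mathbb{R}^n$: maximize $u_{i_1}c_{i_1}+\cdots+u_{i_r}c_{i_r}-c\cdot v$ subject to $v\equiv u\bmod\mathcal{L}_{\mathbb{R}}$ and $v_{i_1},\dots,v_{i_r}\ge 0$ (other coordinates of $v$ unrestricted in sign). *)

theory Defs
  imports "HOL-Analysis.Analysis" "HOL-Library.Poly_Mapping"
begin

section \<open>Lattices and lattice programs\<close>

definition vec_of_nat :: "nat ^ 'n \<Rightarrow> 'a::semiring_1 ^ 'n" where
  "vec_of_nat u = (\<chi> i. of_nat (u $ i))"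

definition vec_of_int :: "int ^ 'n \<Rightarrow> 'a::ring_1 ^ 'n" where
  "vec_of_int u = (\<chi> i. of_int (u $ i))"

definition is_lattice :: "(int ^ 'n) set \<Rightarrow> bool" where
  "is_lattice L \<longleftrightarrow> 0 \<in> L \<and> (\<forall>x\<in>L. \<forall>y\<in>L. x + y \<in> L) \<and> (\<forall>x\<in>L. - x \<in> L)"

definition real_span :: "(int ^ 'n) set \<Rightarrow> (real ^ 'n) set" where
  "real_span L = span (vec_of_int ` L)"

definition lattice_rank :: "(int ^ 'n) set \<Rightarrow> nat" where
  "lattice_rank L = dim (real_span L)"

definition lattice_feasible :: "(int ^ 'n) set \<Rightarrow> nat ^ 'n \<Rightarrow> (nat ^ 'n) set" where
  "lattice_feasible L z = {v. vec_of_nat v - vec_of_nat z \<in> L}"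

definition relaxation_feasible :: "(int ^ 'n) set \<Rightarrow> nat ^ 'n \<Rightarrow> (real ^ 'n) set" where
  "relaxation_feasible L z = {v. v - vec_of_nat z \<in> real_span L \<and> (\<forall>i. 0 \<le> v $ i)}"

definition lattice_programs_bounded :: "(int ^ 'n) set \<Rightarrow> real ^ 'n \<Rightarrow> bool" where
  "lattice_programs_bounded L c \<longleftrightarrow>
     (\<forall>z. bdd_below ((\<lambda>v. c \<bullet> vec_of_nat v) ` lattice_feasible L z))"

definition lattice_optimal_solution ::
  "(int ^ 'n) set \<Rightarrow> real ^ 'n \<Rightarrow> nat ^ 'n \<Rightarrow> nat ^ 'n \<Rightarrow> bool" where
  "lattice_optimal_solution L c z v \<longleftrightarrow>
     is_arg_min (\<lambda>w. c \<bullet> vec_of_nat w) (\<lambda>w. w \<in> lattice_feasible L z) v"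

text \<open>Optimal values are taken in the extended reals, so that unbounded programs have an
  infinite value instead of an unspecified one.\<close>

definition lattice_optimum :: "(int ^ 'n) set \<Rightarrow> real ^ 'n \<Rightarrow> nat ^ 'n \<Rightarrow> ereal" where
  "lattice_optimum L c z = (INF v\<in>lattice_feasible L z. ereal (c \<bullet> vec_of_nat v))"

definition relaxation_optimum :: "(int ^ 'n) set \<Rightarrow> real ^ 'n \<Rightarrow> nat ^ 'n \<Rightarrow> ereal" where
  "relaxation_optimum L c z = (INF v\<in>relaxation_feasible L z. ereal (c \<bullet> v))"

definition is_maximum :: "'a::order set \<Rightarrow> 'a \<Rightarrow> bool" where
  "is_maximum S m \<longleftrightarrow> m \<in> S \<and> (\<forall>x\<in>S. x \<le> m)"

definition gap_set :: "(int ^ 'n) set \<Rightarrow> real ^ 'n \<Rightarrow> ereal set" where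
  "gap_set L c = range (\<lambda>z. lattice_optimum L c z - relaxation_optimum L c z)"

text \<open>The gap is meant to be a maximum; that the supremum is finite and attained is
  expressed separately by \<open>is_maximum (gap_set L c) (lattice_gap L c)\<close> and
  \<open>\<bar>lattice_gap L c\<bar> \<noteq> \<infinity>\<close>.\<close>

definition lattice_gap :: "(int ^ 'n) set \<Rightarrow> real ^ 'n \<Rightarrow> ereal" where
  "lattice_gap L c = Sup (gap_set L c)"

section \<open>Monomial ideals\<close>

text \<open>The polynomial ring \<open>\<real>[x\<^sub>1,\<dots>,x\<^sub>n]\<close> is the monoid algebra of the exponent monoid
  \<open>nat ^ 'n\<close> over \<open>\<real>\<close>; multiplication of finitely supported functions is convolution.\<close>

type_synonym 'n rpoly = "(nat ^ 'n) \<Rightarrow>\<^sub>0 real"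

definition monomial :: "nat ^ 'n \<Rightarrow> 'n::finite rpoly" where
  "monomial u = Poly_Mapping.single u 1"

definition var :: "'n \<Rightarrow> 'n::finite rpoly" where
  "var i = monomial (axis i 1)"

text \<open>An ideal of a commutative ring is a submodule of the ring over itself.\<close>

definition ideal_generated :: "'n::finite rpoly set \<Rightarrow> 'n rpoly set" where
  "ideal_generated G = module.span (*) G"

definition nonoptimal_ideal :: "(int ^ 'n) set \<Rightarrow> real ^ 'n \<Rightarrow> 'n::finite rpoly set" where
  "nonoptimal_ideal L c =
     ideal_generated {monomial u | u. \<not> lattice_optimal_solution L c u u}"

definition component_ideal :: "nat ^ 'n \<Rightarrow> 'n set \<Rightarrow> 'n::finite rpoly set" where
  "component_ideal u \<tau> = ideal_generated {var i ^ (u $ i + 1) | i. i \<in> \<tau>}"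

definition irreducible_monomial_ideal :: "'n::finite rpoly set \<Rightarrow> bool" where
  "irreducible_monomial_ideal J \<longleftrightarrow>
     (\<exists>G. G \<subseteq> {var i ^ k | i k. k \<ge> 1} \<and> J = ideal_generated G)"

definition irredundant_decomposition :: "'n::finite rpoly set \<Rightarrow> 'n rpoly set set \<Rightarrow> bool" where
  "irredundant_decomposition I C \<longleftrightarrow>
     finite C \<and> (\<forall>J\<in>C. irreducible_monomial_ideal J) \<and> \<Inter>C = I \<and>
     (\<forall>J\<in>C. \<Inter>(C - {J}) \<noteq> I)"

definition irreducible_components :: "'n::finite rpoly set \<Rightarrow> 'n rpoly set set" where
  "irreducible_components I = (THE C. irredundant_decomposition I C)"

section \<open>Gap values of irreducible monomial ideals\<close>

definition gap_feasible :: "(int ^ 'n) set \<Rightarrow> nat ^ 'n \<Rightarrow> 'n set \<Rightarrow> (real ^ 'n) set" where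
  "gap_feasible L u \<tau> = {v. v - vec_of_nat u \<in> real_span L \<and> (\<forall>i\<in>\<tau>. 0 \<le> v $ i)}"

definition gap_value :: "(int ^ 'n) set \<Rightarrow> real ^ 'n \<Rightarrow> nat ^ 'n \<Rightarrow> 'n set \<Rightarrow> ereal" where
  "gap_value L c u \<tau> =
     (SUP v\<in>gap_feasible L u \<tau>. ereal ((\<Sum>i\<in>\<tau>. real (u $ i) * c $ i) - c \<bullet> v))"

end

theory Submission
  imports Defs
begin

text \<open>Call a point optimal if it solves the lattice program of its own class. The optimal points
  form a down-closed set, and the ideal \<open>M(L,c)\<close> consists of the polynomials whose exponents
  avoid it. Likewise \<open>I(u,\<tau>)\<close> consists of the polynomials whose exponents avoid the box
  \<open>{w. \<forall>i\<in>\<tau>. w $ i \<le> u $ i}\<close>. An irreducible decomposition of \<open>M(L,c)\<close> therefore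
  writes the set of optimal points as a union of finitely many boxes; Dickson's lemma provides
  such a union (\<open>polys_avoiding_irreducible_decomposition\<close>), and since a box inside a finite union of boxes
  lies inside one of them, the irredundant union is unique
  (\<open>irredundant_decomposition_subset\<close>).

  The gap of the program at \<open>z\<close> is the cost of an optimal point \<open>y\<close> minus the cost of an optimal
  relaxed point. Some box \<open>(u,\<tau>)\<close> of the union contains \<open>y\<close>. After translation by \<open>u - y\<close>
  the relaxed point is feasible for the linear program that defines the gap value of
  \<open>I(u,\<tau>)\<close>, so the gap at \<open>z\<close> is at most this gap value
  (\<open>program_gap_le_gap_value\<close>). Conversely, let \<open>v\<close> be an optimal solution of that linear
  program, and move \<open>u\<close> and \<open>v\<close> far out along the coordinates outside \<open>\<tau>\<close>. The moved \<open>u\<close> is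
  still in the box, hence optimal, and the moved \<open>v\<close> is nonnegative, so the gap there reaches
  the gap value (\<open>gap_value_in_gap_set\<close>). As there are finitely many components, the largest
  gap value is the gap.

  This needs the linear programs to have optimal solutions. A linear program without
  descent directions attains its minimum (\<open>linear_program_attains_minimum\<close>), and a real descent
  direction could be replaced by one in the lattice (\<open>lattice_descent_direction\<close>), which would
  improve some optimal point of the box.\<close>

section \<open>Dickson's lemma\<close>

text \<open>The indices from which on the sequence never drops below its current value are cofinal: a
  minimum of any tail is attained at such an index. They form the subsequence.\<close>

lemma nat_sequence_mono_subsequence:
  fixes g :: "nat \<Rightarrow> nat"
  shows "\<exists>r::nat \<Rightarrow> nat. strict_mono r \<and> mono (\<lambda>k. g (r k))"
proof -
  define Q where "Q = {m. \<forall>k\<ge>m. g m \<le> g k}"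
  have "\<exists>m\<ge>n. m \<in> Q" for n
  proof -
    obtain m where "m \<ge> n" "\<And>k. k \<ge> n \<Longrightarrow> g m \<le> g k"
      using ex_has_least_nat[of "\<lambda>m. m \<ge> n" n g] by auto
    then show ?thesis
      by (intro exI[of _ m]) (simp add: Q_def)
  qed
  then have "infinite Q"
    unfolding infinite_nat_iff_unbounded_le by blast
  then obtain r :: "nat \<Rightarrow> nat" where r: "strict_mono r" "\<And>n. r n \<in> Q"
    using infinite_enumerate by blast
  have "mono (\<lambda>k. g (r k))"
  proof (rule monoI)
    fix x y :: nat
    assume "x \<le> y"
    then have "r x \<le> r y"
      using r(1) strict_mono_less_eq by blast
    then show "g (r x) \<le> g (r y)"
      using r(2)[of x] by (simp add: Q_def)
  qed
  then show ?thesis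
    using r(1) by blast
qed

text \<open>Passing to a further subsequence does not destroy monotonicity in the coordinates that
  were treated before, so the coordinates can be dealt with one after the other.\<close>

lemma nat_vec_sequence_mono_subsequence:
  fixes f :: "nat \<Rightarrow> nat ^ 'n"
  shows "\<exists>r::nat \<Rightarrow> nat. strict_mono r \<and> mono (\<lambda>k. f (r k))"
proof -
  have "\<exists>r::nat \<Rightarrow> nat. strict_mono r \<and> (\<forall>i\<in>A. mono (\<lambda>k. f (r k) $ i))" if "finite A" for A
    using that
  proof (induction A)
    case empty
    show ?case
      using strict_mono_id by blast
  next
    case (insert a A)
    then obtain r :: "nat \<Rightarrow> nat" where r: "strict_mono r" "\<And>i. i \<in> A \<Longrightarrow> mono (\<lambda>k. f (r k) $ i)"
      by blast
    obtain s :: "nat \<Rightarrow> nat" where s: "strict_mono s" "mono (\<lambda>k. f (r (s k)) $ a)"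
      using nat_sequence_mono_subsequence[of "\<lambda>k. f (r k) $ a"] by blast
    have "mono (\<lambda>k. f (r (s k)) $ i)" if "i \<in> A" for i
      using r(2)[OF that] strict_mono_mono[OF s(1)] by (simp add: mono_def)
    then show ?case
      using s strict_mono_o[OF r(1) s(1), unfolded comp_def] by (intro exI[of _ "r \<circ> s"]) auto
  qed
  from this[of UNIV] show ?thesis
    unfolding mono_def less_eq_vec_def by auto
qed

definition minimal_elements :: "'a::order set \<Rightarrow> 'a set" where
  "minimal_elements U = {u \<in> U. \<forall>v\<in>U. v \<le> u \<longrightarrow> v = u}"

lemma minimal_elements_subset: "minimal_elements U \<subseteq> U"
  by (auto simp: minimal_elements_def)

lemma finite_minimal_elements:
  fixes U :: "(nat ^ 'n) set"
  shows "finite (minimal_elements U)"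
proof (rule ccontr)
  assume "infinite (minimal_elements U)"
  then obtain f :: "nat \<Rightarrow> nat ^ 'n" where f: "inj f" "range f \<subseteq> minimal_elements U"
    using infinite_countable_subset by blast
  obtain r :: "nat \<Rightarrow> nat" where r: "strict_mono r" "mono (\<lambda>k. f (r k))"
    using nat_vec_sequence_mono_subsequence by blast
  have "f (r 0) \<le> f (r 1)"
    using r(2) by (simp add: mono_def)
  moreover have "f (r 0) \<in> U" "f (r 1) \<in> minimal_elements U"
    using f(2) minimal_elements_subset by blast+
  ultimately have "f (r 0) = f (r 1)"
    by (auto simp: minimal_elements_def)
  then have "r 0 = r 1"
    using f(1) by (simp add: inj_eq)
  then show False
    using strict_monoD[OF r(1), of 0 1] by simp
qed

lemma exists_minimal_element_below:
  fixes U :: "(nat ^ 'n) set"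
  assumes "u \<in> U"
  shows "\<exists>v\<in>minimal_elements U. v \<le> u"
  using assms
proof (induction "\<Sum>i\<in>UNIV. u $ i" arbitrary: u rule: less_induct)
  case less
  show ?case
  proof (cases "u \<in> minimal_elements U")
    case False
    then obtain v where v: "v \<in> U" "v \<le> u" "v \<noteq> u"
      using less.prems by (auto simp: minimal_elements_def)
    then have "(\<Sum>i\<in>UNIV. v $ i) < (\<Sum>i\<in>UNIV. u $ i)"
      by (intro sum_strict_mono_ex1)
        (auto simp: less_eq_vec_def vec_eq_iff order.strict_iff_order)
    then show ?thesis
      using less.hyps v(1,2) order.trans by blast
  qed auto
qed

section \<open>Linear programs with partial sign constraints\<close>

text \<open>Every feasible point can be replaced by one that is at least as good and has fewest
  nonzero constrained coordinates. Along a direction that keeps the zeros of such a point the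
  cost is constant, since descending would hit a constraint and create a further zero. So the
  zero pattern alone fixes the cost, and there are finitely many costs to compare.\<close>

lemma linear_program_attains_minimum:
  fixes W :: "(real ^ 'n) set" and a c :: "real ^ 'n"
  assumes W: "subspace W"
    and feasible: "P = {v. v - a \<in> W \<and> (\<forall>i\<in>\<tau>. 0 \<le> v $ i)}" "P \<noteq> {}"
    and no_descent: "\<And>l. l \<in> W \<Longrightarrow> \<forall>i\<in>\<tau>. 0 \<le> l $ i \<Longrightarrow> 0 \<le> c \<bullet> l"
  shows "\<exists>v\<in>P. \<forall>w\<in>P. c \<bullet> v \<le> c \<bullet> w"
proof -
  define S where "S v = {i\<in>\<tau>. v $ i \<noteq> 0}" for v :: "real ^ 'n"
  \<comment> \<open>no point at most as expensive has fewer nonzero constrained coordinates\<close>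
  define R where "R = {v\<in>P. \<forall>w\<in>P. c \<bullet> w \<le> c \<bullet> v \<longrightarrow> card (S v) \<le> card (S w)}"
  have reach: "\<exists>w\<in>R. c \<bullet> w \<le> c \<bullet> v" if v: "v \<in> P" for v
  proof -
    obtain w where "w \<in> P" "c \<bullet> w \<le> c \<bullet> v"
      "\<And>w'. w' \<in> P \<Longrightarrow> c \<bullet> w' \<le> c \<bullet> v \<Longrightarrow> card (S w) \<le> card (S w')"
      using ex_has_least_nat[of "\<lambda>w. w \<in> P \<and> c \<bullet> w \<le> c \<bullet> v" v "\<lambda>w. card (S w)"] v
      by (auto simp: conj_assoc)
    then show ?thesis
      by (auto simp: R_def intro!: bexI[of _ w])
  qed
  have shrink: "\<exists>w\<in>P. c \<bullet> w \<le> c \<bullet> v \<and> card (S w) < card (S v)"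
    if v: "v \<in> P" and l: "l \<in> W" "S l \<subseteq> S v" "c \<bullet> l \<le> 0" and neg: "\<exists>i\<in>\<tau>. l $ i < 0" for v l
  proof -
    define N where "N = {i\<in>\<tau>. l $ i < 0}"
    \<comment> \<open>the largest step that keeps all constrained coordinates nonnegative\<close>
    define t where "t = Min ((\<lambda>i. v $ i / - l $ i) ` N)"
    have N: "finite N" "N \<noteq> {}"
      using neg by (auto simp: N_def)
    have t_le: "t \<le> v $ i / - l $ i" if "i \<in> N" for i
      unfolding t_def using N that by (intro Min_le) auto
    have "t \<in> (\<lambda>i. v $ i / - l $ i) ` N"
      unfolding t_def using N by (intro Min_in) auto
    then obtain k where k: "k \<in> N" "t = v $ k / - l $ k"
      by blast
    have v_nonneg: "0 \<le> v $ i" if "i \<in> \<tau>" for i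
      using v that by (simp add: feasible(1))
    have "t \<ge> 0"
      using k v_nonneg[of k] by (simp add: N_def divide_nonneg_neg)
    define w where "w = v + t *\<^sub>R l"
    have "w \<in> P"
    proof -
      have "w - a = (v - a) + t *\<^sub>R l"
        by (simp add: w_def)
      moreover have "v - a \<in> W"
        using v by (simp add: feasible(1))
      ultimately have "w - a \<in> W"
        using subspace_add[OF W _ subspace_scale[OF W l(1)]] by metis
      moreover have "0 \<le> w $ i" if i: "i \<in> \<tau>" for i
      proof (cases "l $ i < 0")
        case True
        then show ?thesis
          using t_le[of i] i by (simp add: N_def w_def field_simps)
      next
        case False
        then show ?thesis
          using v_nonneg[OF i] \<open>t \<ge> 0\<close> by (simp add: w_def)
      qed
      ultimately show ?thesis
        by (simp add: feasible(1))
    qed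
    moreover have "c \<bullet> w \<le> c \<bullet> v"
      using l(3) \<open>t \<ge> 0\<close> by (simp add: w_def inner_add_right mult_nonneg_nonpos)
    moreover have "S w \<subset> S v"
    proof
      show "S w \<subseteq> S v"
        using l(2) by (auto simp: S_def w_def)
      have "k \<in> S l" "k \<notin> S w"
        using k by (auto simp: S_def N_def w_def)
      then show "S w \<noteq> S v"
        using l(2) by blast
    qed
    then have "card (S w) < card (S v)"
      by (intro psubset_card_mono) simp_all
    ultimately show ?thesis
      by blast
  qed
  \<comment> \<open>if \<open>l\<close> or \<open>- l\<close> lowered the cost, it would have a negative constrained coordinate\<close>
  have rigid: "c \<bullet> l = 0" if v: "v \<in> R" and l: "l \<in> W" "S l \<subseteq> S v" for v l
  proof -
    have "v \<in> P"
      using v by (simp add: R_def)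
    have "0 \<le> c \<bullet> k" if k: "k \<in> W" "S k \<subseteq> S v" for k
    proof (rule ccontr)
      assume neg: "\<not> 0 \<le> c \<bullet> k"
      have "\<not> (\<forall>i\<in>\<tau>. 0 \<le> k $ i)"
        using no_descent[OF k(1)] neg by blast
      then obtain w where "w \<in> P" "c \<bullet> w \<le> c \<bullet> v" "card (S w) < card (S v)"
        using shrink[OF \<open>v \<in> P\<close> k] neg by (auto simp: not_le)
      then show False
        using v by (simp add: R_def not_le[symmetric])
    qed
    from this[of l] this[of "- l"] show ?thesis
      using l W by (auto simp: subspace_neg S_def)
  qed
  have same_cost: "c \<bullet> v = c \<bullet> w" if "v \<in> R" "w \<in> R" "S v = S w" for v w
  proof -
    have "(v - a) - (w - a) \<in> W"
      by (rule subspace_diff[OF W]) (use that in \<open>simp_all add: R_def feasible(1)\<close>)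
    moreover have "S (v - w) \<subseteq> S v"
    proof
      fix i
      assume i: "i \<in> S (v - w)"
      then have "\<not> (i \<notin> S v \<and> i \<notin> S w)"
        by (auto simp: S_def)
      then show "i \<in> S v"
        using that(3) by blast
    qed
    ultimately show ?thesis
      using rigid[OF that(1), of "v - w"] by (simp add: inner_diff_right)
  qed
  \<comment> \<open>one representative for each zero pattern\<close>
  define p where "p T = (SOME v. v \<in> R \<and> S v = T)" for T
  have p: "p (S v) \<in> R \<and> S (p (S v)) = S v" if "v \<in> R" for v
    unfolding p_def by (rule someI[of _ v]) (simp add: that)
  have fin: "finite ((\<lambda>v. p (S v)) ` R)"
    by (rule finite_subset[of _ "range p"]) auto
  have "R \<noteq> {}"
    using reach feasible(2) by blast
  then have ne: "(\<lambda>v. p (S v)) ` R \<noteq> {}"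
    by simp
  define u where "u = arg_min_on (\<lambda>v. c \<bullet> v) ((\<lambda>v. p (S v)) ` R)"
  have u: "u \<in> (\<lambda>v. p (S v)) ` R"
    unfolding u_def by (rule arg_min_if_finite(1)[OF fin ne])
  have u_least: "c \<bullet> u \<le> c \<bullet> w" if "w \<in> (\<lambda>v. p (S v)) ` R" for w
    unfolding u_def by (rule arg_min_least[OF fin ne that])
  show ?thesis
  proof (intro bexI ballI)
    show "u \<in> P"
      using u p R_def by blast
    fix w
    assume "w \<in> P"
    then obtain v where v: "v \<in> R" "c \<bullet> v \<le> c \<bullet> w"
      using reach by blast
    have "c \<bullet> u \<le> c \<bullet> p (S v)"
      using v(1) by (intro u_least) blast
    also have "\<dots> = c \<bullet> v"
      using same_cost[of "p (S v)" v] p[OF v(1)] v(1) by simp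
    finally show "c \<bullet> u \<le> c \<bullet> w"
      using v(2) by simp
  qed
qed

section \<open>From real to lattice descent directions\<close>

lemma vec_of_int_diff: "vec_of_int (x - y) = (vec_of_int x - vec_of_int y :: real ^ 'n)"
  by (simp add: vec_of_int_def vec_eq_iff)

lemma is_lattice_diff:
  assumes "is_lattice L" "x \<in> L" "y \<in> L"
  shows "x - y \<in> L"
  using assms unfolding is_lattice_def by (metis diff_conv_add_uminus)

lemma is_lattice_scale_nat:
  assumes "is_lattice L" "x \<in> L"
  shows "(\<chi> i. int k * x $ i) \<in> L"
proof (induction k)
  case 0
  have "(\<chi> i. int 0 * x $ i) = 0"
    by (simp add: vec_eq_iff)
  then show ?case
    using assms(1) by (simp add: is_lattice_def)
next
  case (Suc k)
  have "(\<chi> i. int (Suc k) * x $ i) = (\<chi> i. int k * x $ i) + x"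
    by (simp add: vec_eq_iff algebra_simps)
  then show ?case
    using assms Suc by (simp add: is_lattice_def)
qed

lemma is_lattice_scale:
  assumes "is_lattice L" "x \<in> L"
  shows "(\<chi> i. k * x $ i) \<in> L"
proof (cases "k \<ge> 0")
  case True
  then show ?thesis
    using is_lattice_scale_nat[OF assms, of "nat k"] by simp
next
  case False
  have "(\<chi> i. k * x $ i) = - (\<chi> i. int (nat (- k)) * x $ i)"
    using False by (simp add: vec_eq_iff)
  then show ?thesis
    using is_lattice_scale_nat[OF assms, of "nat (- k)"] assms(1) by (simp add: is_lattice_def)
qed

text \<open>Rounding the coefficients of a combination of lattice vectors to integers costs at most
  the sum of the lengths of these vectors. This bound does not grow with the multiple.\<close>

lemma real_span_multiples_near_lattice:
  assumes L: "is_lattice L" and l: "l \<in> real_span L"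
  shows "\<exists>D. \<forall>N::nat. \<exists>k\<in>L. norm (real N *\<^sub>R l - vec_of_int k) \<le> D"
  using l unfolding real_span_def
proof (induction rule: span_induct_alt)
  case base
  have "(0::int ^ 'a) \<in> L" "vec_of_int 0 = (0 :: real ^ 'a)"
    using L by (auto simp: is_lattice_def vec_of_int_def vec_eq_iff)
  then show ?case
    by (intro exI[of _ 0] allI bexI[of _ 0]) auto
next
  case (step r x y)
  then obtain b where b: "b \<in> L" "x = vec_of_int b"
    by blast
  obtain D where D: "\<And>N::nat. \<exists>k\<in>L. norm (real N *\<^sub>R y - vec_of_int k) \<le> D"
    using step by blast
  have "\<exists>k\<in>L. norm (real N *\<^sub>R (r *\<^sub>R x + y) - vec_of_int k) \<le> norm x + D" for N
  proof -
    obtain k where k: "k \<in> L" "norm (real N *\<^sub>R y - vec_of_int k) \<le> D"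
      using D by blast
    define q where "q = (\<chi> i. \<lfloor>real N * r\<rfloor> * b $ i)"
    have "real N *\<^sub>R (r *\<^sub>R x + y) - vec_of_int (q + k) =
        frac (real N * r) *\<^sub>R x + (real N *\<^sub>R y - vec_of_int k)"
      by (simp add: q_def b(2) vec_eq_iff vec_of_int_def frac_def algebra_simps)
    moreover have "norm (frac (real N * r) *\<^sub>R x) \<le> norm x"
      using frac_lt_1[of "real N * r"] by (simp add: mult_left_le_one_le)
    ultimately have "norm (real N *\<^sub>R (r *\<^sub>R x + y) - vec_of_int (q + k)) \<le> norm x + D"
      using k(2) by (smt (verit) norm_triangle_ineq)
    moreover have "q + k \<in> L"
      using is_lattice_scale[OF L b(1)] k(1) L by (simp add: q_def is_lattice_def)
    ultimately show ?thesis
      by blast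
  qed
  then show ?case
    by blast
qed

text \<open>The lattice points near the multiples \<open>N *\<^sub>R l\<close> may have negative constrained coordinates,
  for example where \<open>l\<close> vanishes. But these coordinates are bounded below, so by the
  combinatorics behind Dickson's lemma they increase along a subsequence. The difference of two
  points of the subsequence is then nonnegative there, and its cost is a large multiple of
  \<open>c \<bullet> l\<close> up to a bounded error.\<close>

lemma lattice_descent_direction:
  fixes L :: "(int ^ 'n) set"
  assumes L: "is_lattice L"
    and l: "l \<in> real_span L" "\<forall>i\<in>\<tau>. 0 \<le> l $ i" "c \<bullet> l < 0"
  shows "\<exists>k\<in>L. (\<forall>i\<in>\<tau>. 0 \<le> k $ i) \<and> c \<bullet> vec_of_int k < 0"
proof -
  obtain D k where k: "\<And>N::nat. k N \<in> L" "\<And>N. norm (real N *\<^sub>R l - vec_of_int (k N)) \<le> D"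
    using real_span_multiples_near_lattice[OF L l(1)] by metis
  have lower: "- \<lceil>D\<rceil> \<le> k N $ i" if "i \<in> \<tau>" for N i
  proof -
    have "\<bar>(real N *\<^sub>R l - vec_of_int (k N)) $ i\<bar> \<le> D"
      using k(2)[of N] component_le_norm_cart order.trans by blast
    then have "real N * l $ i - real_of_int (k N $ i) \<le> D"
      by (simp add: vec_of_int_def)
    moreover have "0 \<le> real N * l $ i"
      using l(2) that by simp
    ultimately have "- real_of_int (k N $ i) \<le> D"
      by linarith
    then show ?thesis
      by linarith
  qed
  \<comment> \<open>adding \<open>\<lceil>D\<rceil>\<close> makes the constrained coordinates nonnegative, so that \<open>nat\<close> keeps their order\<close>
  obtain r :: "nat \<Rightarrow> nat" where r: "strict_mono r" "mono (\<lambda>j. (\<chi> i. nat (k (r j) $ i + \<lceil>D\<rceil>)) :: nat ^ 'n)"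
    using nat_vec_sequence_mono_subsequence[of "\<lambda>N. \<chi> i. nat (k N $ i + \<lceil>D\<rceil>)"] by auto
  obtain j :: nat where j: "real j * - (c \<bullet> l) > 2 * norm c * D"
    using reals_Archimedean3[of "- (c \<bullet> l)"] l(3) by auto
  define d where "d = k (r j) - k (r 0)"
  have "0 \<le> d $ i" if "i \<in> \<tau>" for i
  proof -
    have "nat (k (r 0) $ i + \<lceil>D\<rceil>) \<le> nat (k (r j) $ i + \<lceil>D\<rceil>)"
      using monoD[OF r(2), of 0 j] by (simp add: less_eq_vec_def)
    then show ?thesis
      using lower[OF that, of "r 0"] lower[OF that, of "r j"] by (simp add: d_def)
  qed
  moreover have "d \<in> L"
    using k(1) L by (simp add: d_def is_lattice_diff)
  moreover have "c \<bullet> vec_of_int d < 0"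
  proof -
    define e where "e N = real N *\<^sub>R l - vec_of_int (k N)" for N
    have e: "\<bar>c \<bullet> e N\<bar> \<le> norm c * D" for N
      using Cauchy_Schwarz_ineq2[of c "e N"] mult_left_mono[OF k(2)[of N], of "norm c"]
      by (simp add: e_def)
    have "vec_of_int d = (real (r j) - real (r 0)) *\<^sub>R l + e (r 0) - e (r j)"
      by (simp add: d_def e_def vec_of_int_diff algebra_simps)
    then have eq: "c \<bullet> vec_of_int d = (real (r j) - real (r 0)) * (c \<bullet> l) + c \<bullet> e (r 0) - c \<bullet> e (r j)"
      by (simp add: inner_add_right inner_diff_right)
    have "r 0 + j \<le> r j"
    proof (induction j)
      case (Suc j)
      then show ?case
        using strict_monoD[OF r(1), of j "Suc j"] by simp
    qed simp
    then have "real j \<le> real (r j) - real (r 0)"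
      by linarith
    then have "real j * - (c \<bullet> l) \<le> (real (r j) - real (r 0)) * - (c \<bullet> l)"
      using l(3) by (intro mult_right_mono) auto
    then show ?thesis
      using eq j e[of "r 0"] e[of "r j"] by (auto simp: abs_le_iff)
  qed
  ultimately show ?thesis
    by blast
qed

section \<open>Monomial ideals and their exponents\<close>

text \<open>The product on the polynomial ring makes it a module over itself, so that the library
  facts on spans apply to generated ideals.\<close>

lemma ring_module: "module ((*) :: 'n::finite rpoly \<Rightarrow> _ \<Rightarrow> _)"
  by unfold_locales (simp_all add: algebra_simps)

text \<open>A monomial ideal is determined by the set of exponents whose monomials it omits.\<close>

definition polys_avoiding :: "(nat ^ 'n) set \<Rightarrow> 'n::finite rpoly set" where
  "polys_avoiding D = {f. Poly_Mapping.keys f \<inter> D = {}}"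

lemma monomial_in_polys_avoiding_iff: "monomial w \<in> polys_avoiding D \<longleftrightarrow> w \<notin> D"
  by (simp add: polys_avoiding_def monomial_def)

lemma polys_avoiding_subset_iff: "polys_avoiding D \<subseteq> polys_avoiding D' \<longleftrightarrow> D' \<subseteq> D"
proof
  assume *: "polys_avoiding D \<subseteq> polys_avoiding D'"
  show "D' \<subseteq> D"
    using * monomial_in_polys_avoiding_iff by blast
qed (auto simp: polys_avoiding_def)

lemma ideal_generated_monomials:
  "ideal_generated (monomial ` U) = polys_avoiding {w. \<forall>u\<in>U. \<not> u \<le> w}"
proof
  interpret module "(*) :: 'a rpoly \<Rightarrow> _ \<Rightarrow> _"
    by (rule ring_module)
  define D where "D = {w. \<forall>u\<in>U. \<not> u \<le> w}"
  have down: "b \<in> D" if "a + b \<in> D" for a b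
  proof -
    have "u \<le> a + b" if "u \<le> b" for u
      using that by (auto simp: less_eq_vec_def intro: trans_le_add2)
    then show ?thesis
      using that by (auto simp: D_def)
  qed
  have "subspace (polys_avoiding D)"
  proof (rule subspaceI)
    fix f g :: "'a rpoly"
    assume "g \<in> polys_avoiding D"
    then show "f * g \<in> polys_avoiding D"
      using keys_mult[of f g] down by (fastforce simp: polys_avoiding_def)
  qed (use keys_add in \<open>fastforce simp: polys_avoiding_def\<close>)+
  then show "ideal_generated (monomial ` U) \<subseteq> polys_avoiding {w. \<forall>u\<in>U. \<not> u \<le> w}"
    unfolding ideal_generated_def D_def[symmetric]
    by (intro span_minimal) (auto simp: monomial_in_polys_avoiding_iff D_def)
  show "polys_avoiding {w. \<forall>u\<in>U. \<not> u \<le> w} \<subseteq> ideal_generated (monomial ` U)"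
  proof
    fix f :: "'a rpoly"
    assume f: "f \<in> polys_avoiding {w. \<forall>u\<in>U. \<not> u \<le> w}"
    have "Poly_Mapping.single w (Poly_Mapping.lookup f w) \<in> span (monomial ` U)"
      if "w \<in> Poly_Mapping.keys f" for w
    proof -
      obtain u where u: "u \<in> U" "u \<le> w"
        using f \<open>w \<in> Poly_Mapping.keys f\<close> by (auto simp: polys_avoiding_def)
      then have "w = (\<chi> i. w $ i - u $ i) + u"
        by (simp add: vec_eq_iff less_eq_vec_def)
      then have "Poly_Mapping.single w (Poly_Mapping.lookup f w) =
          Poly_Mapping.single (\<chi> i. w $ i - u $ i) (Poly_Mapping.lookup f w) * monomial u"
        by (metis monomial_def mult.right_neutral mult_single)
      then show ?thesis
        using span_scale[OF span_base] u(1) by simp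
    qed
    then have "(\<Sum>w\<in>Poly_Mapping.keys f. Poly_Mapping.single w (Poly_Mapping.lookup f w)) \<in> span (monomial ` U)"
      by (rule span_sum)
    moreover have "f = (\<Sum>w\<in>Poly_Mapping.keys f. Poly_Mapping.single w (Poly_Mapping.lookup f w))"
      by (rule poly_mapping_eqI)
        (auto simp: lookup_sum lookup_single when_def in_keys_iff sum.delta)
    ultimately show "f \<in> ideal_generated (monomial ` U)"
      unfolding ideal_generated_def by (rule back_subst[of "\<lambda>g. g \<in> _", OF _ sym])
  qed
qed

lemma var_power: "var i ^ k = monomial (axis i k)"
proof (induction k)
  case 0
  have "axis i 0 = (0 :: nat ^ 'a)"
    by (simp add: axis_def vec_eq_iff)
  then have "monomial (axis i 0) = (1 :: 'a rpoly)"
    by (simp only: monomial_def single_one)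
  then show ?case
    by simp
next
  case (Suc k)
  have "axis i (Suc k) = axis i 1 + (axis i k :: nat ^ 'a)"
    by (simp add: axis_def vec_eq_iff)
  then show ?case
    using Suc by (simp add: var_def monomial_def mult_single)
qed

lemma ideal_generated_var_powers:
  "ideal_generated ((\<lambda>(i, k). var i ^ k) ` E) = polys_avoiding {w. \<forall>(i, k)\<in>E. w $ i < k}"
proof -
  have le: "axis i k \<le> w \<longleftrightarrow> k \<le> w $ i" for i k and w :: "nat ^ 'a"
    by (auto simp: less_eq_vec_def axis_def)
  have "(\<lambda>(i, k). var i ^ k) ` E = monomial ` (\<lambda>(i, k). axis i k) ` E"
    by (auto simp: var_power image_image split_beta)
  then show ?thesis
    by (simp add: ideal_generated_monomials le not_le split_beta)
qed

definition lower_box :: "nat ^ 'n \<Rightarrow> 'n set \<Rightarrow> (nat ^ 'n) set" where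
  "lower_box u \<tau> = {w. \<forall>i\<in>\<tau>. w $ i \<le> u $ i}"

lemma component_ideal_eq: "component_ideal u \<tau> = polys_avoiding (lower_box u \<tau>)"
proof -
  have "{var i ^ (u $ i + 1) | i. i \<in> \<tau>} = (\<lambda>(i, k). var i ^ k) ` (\<lambda>i. (i, u $ i + 1)) ` \<tau>"
    unfolding image_image by (simp only: prod.case Setcompr_eq_image)
  then show ?thesis
    unfolding component_ideal_def
    by (simp only: ideal_generated_var_powers) (simp add: lower_box_def less_Suc_eq_le)
qed

text \<open>Among the generating powers of one variable only the smallest matters.\<close>

lemma irreducible_monomial_ideal_is_component_ideal:
  assumes "irreducible_monomial_ideal J"
  shows "\<exists>u \<tau>. (\<forall>j. j \<notin> \<tau> \<longrightarrow> u $ j = 0) \<and> J = component_ideal u \<tau>"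
proof -
  obtain G where G: "G \<subseteq> {var i ^ k | i k. k \<ge> 1}" "J = ideal_generated G"
    using assms by (auto simp: irreducible_monomial_ideal_def)
  define E where "E = {(i, k). k \<ge> 1 \<and> var i ^ k \<in> G}"
  define \<tau> where "\<tau> = fst ` E"
  define u :: "nat ^ 'a" where
    "u = (\<chi> i. if i \<in> \<tau> then (LEAST k. (i, k) \<in> E) - 1 else 0)"
  have "G = (\<lambda>(i, k). var i ^ k) ` E"
    using G(1) by (fastforce simp: E_def image_iff)
  then have J: "J = polys_avoiding {w. \<forall>(i, k)\<in>E. w $ i < k}"
    using G(2) ideal_generated_var_powers by simp
  have E: "(\<forall>k. (i, k) \<in> E \<longrightarrow> n < k) \<longleftrightarrow> n \<le> u $ i" if i: "i \<in> \<tau>" for i n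
  proof -
    obtain k0 where "(i, k0) \<in> E"
      using i by (auto simp: \<tau>_def)
    then have least: "(i, LEAST k. (i, k) \<in> E) \<in> E"
      by (rule LeastI)
    then have "(LEAST k. (i, k) \<in> E) \<ge> 1"
      by (simp add: E_def)
    then have "n \<le> u $ i \<longleftrightarrow> n < (LEAST k. (i, k) \<in> E)"
      using i by (auto simp: u_def)
    then show ?thesis
      using least Least_le[of "\<lambda>k. (i, k) \<in> E"] by (meson less_le_trans)
  qed
  have "{w. \<forall>(i, k)\<in>E. w $ i < k} = {w. \<forall>i\<in>\<tau>. \<forall>k. (i, k) \<in> E \<longrightarrow> w $ i < k}"
    by (force simp: \<tau>_def)
  also have "\<dots> = lower_box u \<tau>"
    using E by (auto simp: lower_box_def)
  finally have "J = component_ideal u \<tau>"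
    using J by (simp add: component_ideal_eq)
  moreover have "\<forall>j. j \<notin> \<tau> \<longrightarrow> u $ j = 0"
    by (simp add: u_def)
  ultimately show ?thesis
    by blast
qed

section \<open>Irreducible decompositions\<close>

text \<open>If no factor lies in \<open>J\<close>, then each factor contains a monomial from the box of \<open>J\<close>. These
  finitely many exponents have a common upper bound in the box, and its monomial lies in all
  factors but not in \<open>J\<close>.\<close>

lemma irreducible_monomial_ideal_contains_factor:
  fixes J :: "'n::finite rpoly set"
  assumes "irreducible_monomial_ideal J" "finite C" "\<forall>K\<in>C. irreducible_monomial_ideal K"
    and "\<Inter>C \<subseteq> J"
  shows "\<exists>K\<in>C. K \<subseteq> J"
proof (rule ccontr)
  assume none: "\<not> ?thesis"
  obtain u \<tau> where J: "J = component_ideal u \<tau>"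
    using irreducible_monomial_ideal_is_component_ideal assms(1) by blast
  have "\<exists>w. w \<in> lower_box u \<tau> \<and> (\<forall>w'. w \<le> w' \<longrightarrow> monomial w' \<in> K)" if K: "K \<in> C" for K
  proof -
    obtain v \<sigma> where v: "K = component_ideal v \<sigma>"
      using irreducible_monomial_ideal_is_component_ideal assms(3) K by blast
    have "\<not> K \<subseteq> J"
      using none K by blast
    then have "\<not> lower_box u \<tau> \<subseteq> lower_box v \<sigma>"
      by (simp add: J v component_ideal_eq polys_avoiding_subset_iff)
    then obtain w where w: "w \<in> lower_box u \<tau>" "w \<notin> lower_box v \<sigma>"
      by blast
    then have "w' \<notin> lower_box v \<sigma>" if "w \<le> w'" for w'
      using that by (force simp: lower_box_def less_eq_vec_def intro: order.trans)
    then show ?thesis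
      using w(1) by (auto simp: v component_ideal_eq monomial_in_polys_avoiding_iff)
  qed
  then obtain w where w: "\<And>K. K \<in> C \<Longrightarrow> w K \<in> lower_box u \<tau>"
    "\<And>K w'. K \<in> C \<Longrightarrow> w K \<le> w' \<Longrightarrow> monomial w' \<in> K"
    by metis
  \<comment> \<open>outside \<open>\<tau>\<close> the sum serves as an upper bound\<close>
  define x where "x = (\<chi> i. if i \<in> \<tau> then u $ i else \<Sum>K\<in>C. w K $ i)"
  have "w K \<le> x" if "K \<in> C" for K
    using w(1)[OF that] assms(2) that
    by (auto simp: x_def less_eq_vec_def lower_box_def intro: member_le_sum)
  then have "monomial x \<in> J"
    using w(2) assms(4) by blast
  then show False
    by (simp add: J component_ideal_eq monomial_in_polys_avoiding_iff lower_box_def x_def)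
qed

text \<open>Each \<open>J \<in> C\<close> contains some \<open>K \<in> C'\<close>, which contains some \<open>J' \<in> C\<close>. Irredundancy of \<open>C\<close>
  forces \<open>J' = J\<close>, and so \<open>K = J\<close>.\<close>

lemma irredundant_decomposition_subset:
  assumes C: "irredundant_decomposition I C" and C': "irredundant_decomposition I C'"
  shows "C \<subseteq> C'"
proof
  fix J
  assume J: "J \<in> C"
  have "\<Inter>C' \<subseteq> J"
    using C C' J by (auto simp: irredundant_decomposition_def)
  then obtain K where K: "K \<in> C'" "K \<subseteq> J"
    using irreducible_monomial_ideal_contains_factor[of J C'] C C' J
    by (auto simp: irredundant_decomposition_def)
  have "\<Inter>C \<subseteq> K"
    using C C' K(1) by (auto simp: irredundant_decomposition_def)
  then obtain J' where J': "J' \<in> C" "J' \<subseteq> K"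
    using irreducible_monomial_ideal_contains_factor[of K C] C C' K(1)
    by (auto simp: irredundant_decomposition_def)
  have "J' = J"
  proof (rule ccontr)
    assume "J' \<noteq> J"
    then have "J' \<in> C - {J}"
      using J'(1) by blast
    then have "\<Inter>(C - {J}) \<subseteq> J"
      using J'(2) K(2) by blast
    then have "\<Inter>(C - {J}) = \<Inter>C"
      by blast
    then show False
      using C J by (auto simp: irredundant_decomposition_def)
  qed
  then show "J \<in> C'"
    using J'(2) K by (metis subset_antisym)
qed

text \<open>By Dickson's lemma the complement of a down-closed set has finitely many minimal elements
  \<open>g\<close>. Being in the down-closed set means that for each \<open>g\<close> some coordinate is smaller
  than that of \<open>g\<close>; distributing over the choice of this coordinate gives boxes.\<close>

lemma polys_avoiding_irreducible_decomposition:
  fixes D :: "(nat ^ 'n) set"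
  assumes down: "\<And>v w. w \<in> D \<Longrightarrow> v \<le> w \<Longrightarrow> v \<in> D"
  shows "\<exists>C. finite C \<and> (\<forall>J\<in>C. irreducible_monomial_ideal J) \<and> \<Inter>C = polys_avoiding D"
proof -
  define G where "G = minimal_elements (- D)"
  define F where "F = (\<Pi>\<^sub>E g\<in>G. {i. g $ i \<ge> 1})"
  define J where "J f = ideal_generated ((\<lambda>(i, k). var i ^ k) ` (\<lambda>g. (f g, g $ f g)) ` G)"
    for f :: "nat ^ 'n \<Rightarrow> 'n"
  have G: "w \<in> D \<longleftrightarrow> (\<forall>g\<in>G. \<not> g \<le> w)" for w
    using down exists_minimal_element_below[of w "- D"] minimal_elements_subset[of "- D"]
    unfolding G_def by blast
  have D: "w \<in> D \<longleftrightarrow> (\<exists>f\<in>F. \<forall>g\<in>G. w $ f g < g $ f g)" for w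
  proof
    assume "w \<in> D"
    then have "\<forall>g\<in>G. \<exists>i. w $ i < g $ i"
      by (simp add: G less_eq_vec_def not_le)
    then obtain f where f: "\<And>g. g \<in> G \<Longrightarrow> w $ f g < g $ f g"
      by metis
    then have "restrict f G \<in> F"
      by (force simp: F_def)
    then show "\<exists>f\<in>F. \<forall>g\<in>G. w $ f g < g $ f g"
      using f by (intro bexI[of _ "restrict f G"]) auto
  next
    assume "\<exists>f\<in>F. \<forall>g\<in>G. w $ f g < g $ f g"
    then show "w \<in> D"
      by (auto simp: G less_eq_vec_def not_le)
  qed
  have J: "J f = polys_avoiding {w. \<forall>g\<in>G. w $ f g < g $ f g}" for f
    by (simp add: J_def ideal_generated_var_powers)
  have "irreducible_monomial_ideal (J f)" if "f \<in> F" for f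
    unfolding irreducible_monomial_ideal_def J_def
    using that by (intro exI conjI refl) (auto simp: F_def PiE_iff)
  moreover have "finite (J ` F)"
    by (simp add: F_def G_def finite_minimal_elements finite_PiE)
  moreover have "\<Inter>(J ` F) = polys_avoiding D"
    by (auto simp: J polys_avoiding_def D disjoint_iff)
  ultimately show ?thesis
    by blast
qed

text \<open>A subfamily of least cardinality with the same intersection is irredundant.\<close>

lemma irredundant_decomposition_exists:
  assumes "finite C" "\<forall>J\<in>C. irreducible_monomial_ideal J" "\<Inter>C = I"
  shows "\<exists>C. irredundant_decomposition I C"
proof -
  define Q where "Q B \<longleftrightarrow> B \<subseteq> C \<and> \<Inter>B = I" for B
  obtain B where B: "Q B" "\<And>B'. Q B' \<Longrightarrow> card B \<le> card B'"
    using ex_has_least_nat[of Q C card] assms(3) by (auto simp: Q_def)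
  have "finite B"
    using B(1) assms(1) finite_subset by (auto simp: Q_def)
  have "\<Inter>(B - {J}) \<noteq> I" if "J \<in> B" for J
  proof
    assume "\<Inter>(B - {J}) = I"
    then have "Q (B - {J})"
      using B(1) by (auto simp: Q_def)
    then have "card B \<le> card (B - {J})"
      by (rule B(2))
    then show False
      using card_Diff1_less[OF \<open>finite B\<close> that] by simp
  qed
  then have "irredundant_decomposition I B"
    using B(1) \<open>finite B\<close> assms(2) by (auto simp: irredundant_decomposition_def Q_def)
  then show ?thesis
    by blast
qed

lemma irreducible_components_polys_avoiding:
  fixes D :: "(nat ^ 'n) set"
  assumes "\<And>v w. w \<in> D \<Longrightarrow> v \<le> w \<Longrightarrow> v \<in> D"
  shows "irredundant_decomposition (polys_avoiding D) (irreducible_components (polys_avoiding D))"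
proof -
  have "\<exists>C. finite C \<and> (\<forall>J\<in>C. irreducible_monomial_ideal J) \<and> \<Inter>C = polys_avoiding D"
    using assms by (rule polys_avoiding_irreducible_decomposition)
  then have "\<exists>C. irredundant_decomposition (polys_avoiding D) C"
    using irredundant_decomposition_exists by blast
  then have "\<exists>!C. irredundant_decomposition (polys_avoiding D) C"
    using irredundant_decomposition_subset by (metis subset_antisym)
  then show ?thesis
    unfolding irreducible_components_def by (rule theI')
qed

section \<open>Optimal points of lattice programs\<close>

lemma vec_of_nat_in_real_span:
  assumes "vec_of_nat v - vec_of_nat w \<in> L"
  shows "vec_of_nat v - vec_of_nat w \<in> real_span L"
proof -
  have "vec_of_int (vec_of_nat v - vec_of_nat w) = (vec_of_nat v - vec_of_nat w :: real ^ 'a)"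
    by (simp add: vec_of_int_def vec_of_nat_def vec_eq_iff)
  then have "vec_of_nat v - vec_of_nat w \<in> (vec_of_int ` L :: (real ^ 'a) set)"
    using assms by (intro image_eqI[OF sym])
  then show ?thesis
    by (simp add: real_span_def span_base)
qed

lemma lattice_optimal_solution_iff:
  "lattice_optimal_solution L c z v \<longleftrightarrow>
    v \<in> lattice_feasible L z \<and>
    (\<forall>w\<in>lattice_feasible L z. c \<bullet> vec_of_nat v \<le> c \<bullet> vec_of_nat w)"
  by (auto simp: lattice_optimal_solution_def is_arg_min_linorder)

locale bounded_lattice_programs =
  fixes L :: "(int ^ 'n) set" and c :: "real ^ 'n"
  assumes lattice: "is_lattice L"
    and bounded: "lattice_programs_bounded L c"
begin

lemma lattice_feasible_eq:
  assumes "v \<in> lattice_feasible L z"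
  shows "lattice_feasible L v = lattice_feasible L z"
proof -
  have v: "vec_of_nat v - vec_of_nat z \<in> L"
    using assms by (simp add: lattice_feasible_def)
  have "vec_of_nat w - vec_of_nat v \<in> L \<longleftrightarrow> vec_of_nat w - vec_of_nat z \<in> L" for w
  proof
    assume "vec_of_nat w - vec_of_nat v \<in> L"
    then have "(vec_of_nat w - vec_of_nat v) + (vec_of_nat v - vec_of_nat z) \<in> L"
      using v lattice unfolding is_lattice_def by blast
    then show "vec_of_nat w - vec_of_nat z \<in> L"
      by simp
  next
    assume "vec_of_nat w - vec_of_nat z \<in> L"
    then show "vec_of_nat w - vec_of_nat v \<in> L"
      using is_lattice_diff[OF lattice _ v] by fastforce
  qed
  then show ?thesis
    by (simp add: lattice_feasible_def)
qed

lemma self_feasible: "z \<in> lattice_feasible L z"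
  using lattice by (simp add: lattice_feasible_def is_lattice_def)

text \<open>Otherwise the multiples of \<open>k\<close> are feasible for the class of \<open>0\<close> and have costs unbounded below.\<close>

lemma nonneg_lattice_vector_cost:
  assumes k: "k \<in> L" "\<forall>i. 0 \<le> k $ i"
  shows "0 \<le> c \<bullet> vec_of_int k"
proof (rule ccontr)
  assume "\<not> 0 \<le> c \<bullet> vec_of_int k"
  obtain B where B: "\<And>v. v \<in> lattice_feasible L 0 \<Longrightarrow> B \<le> c \<bullet> vec_of_nat v"
    using bounded unfolding lattice_programs_bounded_def bdd_below_def by blast
  have "0 < - (c \<bullet> vec_of_int k)"
    using \<open>\<not> 0 \<le> c \<bullet> vec_of_int k\<close> by simp
  then obtain N :: nat where N: "- B < real N * - (c \<bullet> vec_of_int k)"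
    using reals_Archimedean3 by blast
  define v :: "nat ^ 'n" where "v = (\<chi> i. nat (int N * k $ i))"
  have "vec_of_nat v - vec_of_nat 0 = (\<chi> i. int N * k $ i)"
    using k(2) by (simp add: v_def vec_of_nat_def vec_eq_iff)
  then have "v \<in> lattice_feasible L 0"
    using is_lattice_scale_nat[OF lattice k(1)] by (simp add: lattice_feasible_def)
  moreover have "vec_of_nat v = (real N *\<^sub>R vec_of_int k :: real ^ 'n)"
    using k(2) by (simp add: v_def vec_of_nat_def vec_of_int_def vec_eq_iff)
  ultimately have "B \<le> real N * (c \<bullet> vec_of_int k)"
    using B[of v] by simp
  then show False
    using N by simp
qed

text \<open>If \<open>y \<le> w\<close> are both feasible, then \<open>w - y\<close> is a nonnegative lattice vector, and \<open>y\<close> costs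
  no more than \<open>w\<close>. So it suffices to compare the minimal feasible points, which are finitely
  many by Dickson's lemma.\<close>

lemma lattice_optimal_solution_exists: "\<exists>v. lattice_optimal_solution L c z v"
proof -
  define M where "M = minimal_elements (lattice_feasible L z)"
  have ne: "M \<noteq> {}" and fin: "finite M"
    using exists_minimal_element_below[OF self_feasible[of z]] finite_minimal_elements
    by (auto simp: M_def)
  define v where "v = arg_min_on (\<lambda>v. c \<bullet> vec_of_nat v) M"
  have "v \<in> M"
    unfolding v_def by (rule arg_min_if_finite(1)[OF fin ne])
  then have v: "v \<in> lattice_feasible L z"
    using minimal_elements_subset by (auto simp: M_def)
  have "c \<bullet> vec_of_nat v \<le> c \<bullet> vec_of_nat w" if w: "w \<in> lattice_feasible L z" for w
  proof -
    obtain y where y: "y \<in> M" "y \<le> w"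
      using exists_minimal_element_below[OF w] by (auto simp: M_def)
    define k :: "int ^ 'n" where "k = vec_of_nat w - vec_of_nat y"
    have "y \<in> lattice_feasible L z"
      using y(1) minimal_elements_subset by (auto simp: M_def)
    then have "w \<in> lattice_feasible L y"
      using w lattice_feasible_eq by blast
    then have "k \<in> L"
      by (simp add: k_def lattice_feasible_def)
    moreover have "\<forall>i. 0 \<le> k $ i"
      using y(2) by (simp add: k_def vec_of_nat_def less_eq_vec_def)
    ultimately have "0 \<le> c \<bullet> vec_of_int k"
      by (rule nonneg_lattice_vector_cost)
    moreover have "vec_of_int k = (vec_of_nat w - vec_of_nat y :: real ^ 'n)"
      by (simp add: k_def vec_of_int_def vec_of_nat_def vec_eq_iff)
    ultimately have "c \<bullet> vec_of_nat y \<le> c \<bullet> vec_of_nat w"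
      by (simp add: inner_diff_right)
    moreover have "c \<bullet> vec_of_nat v \<le> c \<bullet> vec_of_nat y"
      unfolding v_def by (rule arg_min_least[OF fin ne y(1)])
    ultimately show ?thesis
      by simp
  qed
  then show ?thesis
    using v by (auto simp: lattice_optimal_solution_iff)
qed

definition optimal_points :: "(nat ^ 'n) set" where
  "optimal_points = {u. lattice_optimal_solution L c u u}"

lemma lattice_optimal_solution_in_optimal_points:
  assumes "lattice_optimal_solution L c z v"
  shows "v \<in> optimal_points"
  using assms lattice_feasible_eq[of v z]
  by (auto simp: optimal_points_def lattice_optimal_solution_iff)

text \<open>If \<open>v'\<close> improves on \<open>v\<close>, then \<open>v' + (w - v)\<close> improves on \<open>w\<close>.\<close>

lemma optimal_points_down_closed:
  assumes w: "w \<in> optimal_points" and le: "v \<le> w"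
  shows "v \<in> optimal_points"
proof -
  have "c \<bullet> vec_of_nat v \<le> c \<bullet> vec_of_nat v'" if v': "v' \<in> lattice_feasible L v" for v'
  proof -
    define w' where "w' = (\<chi> i. v' $ i + (w $ i - v $ i))"
    have "vec_of_nat w' - vec_of_nat w = (vec_of_nat v' - vec_of_nat v :: int ^ 'n)"
      using le by (simp add: w'_def vec_of_nat_def vec_eq_iff less_eq_vec_def of_nat_diff trans_le_add2)
    then have "w' \<in> lattice_feasible L w"
      using v' by (simp add: lattice_feasible_def)
    then have "c \<bullet> vec_of_nat w \<le> c \<bullet> vec_of_nat w'"
      using w by (simp add: optimal_points_def lattice_optimal_solution_iff)
    moreover have "vec_of_nat w' = vec_of_nat v' + (vec_of_nat w - vec_of_nat v :: real ^ 'n)"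
      using le by (simp add: w'_def vec_of_nat_def vec_eq_iff less_eq_vec_def of_nat_diff trans_le_add2)
    ultimately show ?thesis
      by (simp add: inner_add_right inner_diff_right)
  qed
  then show ?thesis
    using self_feasible by (simp add: optimal_points_def lattice_optimal_solution_iff)
qed

lemma nonoptimal_ideal_eq: "nonoptimal_ideal L c = polys_avoiding optimal_points"
proof -
  have "{monomial u | u. \<not> lattice_optimal_solution L c u u} = monomial ` (- optimal_points)"
    by (auto simp: optimal_points_def)
  moreover have "{w. \<forall>u\<in>- optimal_points. \<not> u \<le> w} = optimal_points"
    using optimal_points_down_closed by blast
  ultimately show ?thesis
    by (simp add: nonoptimal_ideal_def ideal_generated_monomials)
qed

section \<open>Gap values of boxes of optimal points\<close>

text \<open>A lattice descent direction that is nonnegative on \<open>\<tau>\<close> improves the points of the box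
  that are large enough outside \<open>\<tau>\<close>.\<close>

lemma optimal_box_no_descent:
  assumes box: "lower_box u \<tau> \<subseteq> optimal_points"
    and l: "l \<in> real_span L" "\<forall>i\<in>\<tau>. 0 \<le> l $ i"
  shows "0 \<le> c \<bullet> l"
proof (rule ccontr)
  assume "\<not> 0 \<le> c \<bullet> l"
  then have "c \<bullet> l < 0"
    by simp
  then obtain k where k: "k \<in> L" "\<forall>i\<in>\<tau>. 0 \<le> k $ i" "c \<bullet> vec_of_int k < 0"
    using lattice_descent_direction[OF lattice l] by blast
  define w :: "nat ^ 'n" where "w = (\<chi> i. if i \<in> \<tau> then 0 else nat \<bar>k $ i\<bar>)"
  define w' :: "nat ^ 'n" where "w' = (\<chi> i. nat (int (w $ i) + k $ i))"
  have nonneg: "0 \<le> int (w $ i) + k $ i" for i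
    using k(2) abs_ge_minus_self[of "k $ i"] by (auto simp: w_def)
  have "vec_of_nat w' - vec_of_nat w = k"
    using nonneg by (simp add: w'_def vec_of_nat_def vec_eq_iff)
  then have "w' \<in> lattice_feasible L w"
    using k(1) by (simp add: lattice_feasible_def)
  moreover have "w \<in> optimal_points"
    using box by (auto simp: lower_box_def w_def)
  ultimately have "c \<bullet> vec_of_nat w \<le> c \<bullet> vec_of_nat w'"
    by (simp add: optimal_points_def lattice_optimal_solution_iff)
  moreover have "vec_of_nat w' = (vec_of_nat w + vec_of_int k :: real ^ 'n)"
    using nonneg by (simp add: w'_def vec_of_nat_def vec_of_int_def vec_eq_iff)
  ultimately show False
    using k(3) by (simp add: inner_add_right)
qed

lemma gap_value_attained:
  assumes box: "lower_box u \<tau> \<subseteq> optimal_points" and u: "\<forall>j. j \<notin> \<tau> \<longrightarrow> u $ j = 0"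
  shows "\<exists>v\<in>gap_feasible L u \<tau>. gap_value L c u \<tau> = ereal (c \<bullet> vec_of_nat u - c \<bullet> v) \<and>
    (\<forall>w\<in>gap_feasible L u \<tau>. c \<bullet> v \<le> c \<bullet> w)"
proof -
  have "vec_of_nat u \<in> gap_feasible L u \<tau>"
    by (simp add: gap_feasible_def real_span_def span_zero vec_of_nat_def)
  then obtain v where v: "v \<in> gap_feasible L u \<tau>" "\<forall>w\<in>gap_feasible L u \<tau>. c \<bullet> v \<le> c \<bullet> w"
    using linear_program_attains_minimum[OF _ gap_feasible_def, of L u \<tau> c]
      optimal_box_no_descent[OF box] by (auto simp: real_span_def)
  have "(\<Sum>i\<in>\<tau>. real (u $ i) * c $ i) = (\<Sum>i\<in>UNIV. real (u $ i) * c $ i)"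
    using u by (intro sum.mono_neutral_left) auto
  then have cost: "(\<Sum>i\<in>\<tau>. real (u $ i) * c $ i) = c \<bullet> vec_of_nat u"
    by (simp add: inner_vec_def vec_of_nat_def mult.commute)
  have "gap_value L c u \<tau> = ereal (c \<bullet> vec_of_nat u - c \<bullet> v)"
    unfolding gap_value_def cost
    using v by (intro antisym SUP_least SUP_upper2[of v]) auto
  then show ?thesis
    using v by blast
qed

lemma relaxation_attained:
  "\<exists>v\<in>relaxation_feasible L z. relaxation_optimum L c z = ereal (c \<bullet> v) \<and>
    (\<forall>w\<in>relaxation_feasible L z. c \<bullet> v \<le> c \<bullet> w)"
proof -
  have "\<exists>v\<in>relaxation_feasible L z. \<forall>w\<in>relaxation_feasible L z. c \<bullet> v \<le> c \<bullet> w"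
  proof (rule linear_program_attains_minimum)
    show "subspace (real_span L)"
      by (simp add: real_span_def)
    show "relaxation_feasible L z =
        {v. v - vec_of_nat z \<in> real_span L \<and> (\<forall>i\<in>UNIV. 0 \<le> v $ i)}"
      by (simp add: relaxation_feasible_def)
    have "vec_of_nat z \<in> relaxation_feasible L z"
      by (simp add: relaxation_feasible_def real_span_def span_zero vec_of_nat_def)
    then show "relaxation_feasible L z \<noteq> {}"
      by blast
    fix l
    assume l: "l \<in> real_span L" "\<forall>i\<in>UNIV. 0 \<le> l $ i"
    show "0 \<le> c \<bullet> l"
      using lattice_descent_direction[OF lattice l, of c] nonneg_lattice_vector_cost
      by (meson UNIV_I not_le)
  qed
  then obtain v where v: "v \<in> relaxation_feasible L z"
    "\<forall>w\<in>relaxation_feasible L z. c \<bullet> v \<le> c \<bullet> w"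
    by blast
  then have "relaxation_optimum L c z = ereal (c \<bullet> v)"
    unfolding relaxation_optimum_def by (intro antisym INF_greatest INF_lower2[of v]) auto
  then show ?thesis
    using v by blast
qed

lemma program_gap_eq:
  assumes "lattice_optimal_solution L c z y"
  shows "\<exists>v\<in>relaxation_feasible L z.
    lattice_optimum L c z - relaxation_optimum L c z = ereal (c \<bullet> vec_of_nat y - c \<bullet> v) \<and>
    (\<forall>w\<in>relaxation_feasible L z. c \<bullet> v \<le> c \<bullet> w)"
proof -
  have "lattice_optimum L c z = ereal (c \<bullet> vec_of_nat y)"
    using assms unfolding lattice_optimum_def lattice_optimal_solution_iff
    by (intro antisym INF_greatest INF_lower2[of y]) auto
  then show ?thesis
    using relaxation_attained[of z] by auto
qed

text \<open>Translating a relaxed solution by \<open>u - y\<close> keeps the coordinates in \<open>\<tau>\<close>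
  nonnegative, since \<open>y\<close> lies in the box, and moves the class of \<open>y\<close> to that of \<open>u\<close>.\<close>

lemma program_gap_le_gap_value:
  assumes box: "lower_box u \<tau> \<subseteq> optimal_points" and u: "\<forall>j. j \<notin> \<tau> \<longrightarrow> u $ j = 0"
    and y: "lattice_optimal_solution L c z y" "y \<in> lower_box u \<tau>"
  shows "lattice_optimum L c z - relaxation_optimum L c z \<le> gap_value L c u \<tau>"
proof -
  obtain v where v: "v \<in> relaxation_feasible L z"
    "lattice_optimum L c z - relaxation_optimum L c z = ereal (c \<bullet> vec_of_nat y - c \<bullet> v)"
    using program_gap_eq[OF y(1)] by blast
  obtain v' where v': "gap_value L c u \<tau> = ereal (c \<bullet> vec_of_nat u - c \<bullet> v')"
    "\<forall>w\<in>gap_feasible L u \<tau>. c \<bullet> v' \<le> c \<bullet> w"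
    using gap_value_attained[OF box u] by blast
  define w where "w = v + (vec_of_nat u - vec_of_nat y)"
  have "vec_of_nat y - vec_of_nat z \<in> real_span L"
    using y(1) by (intro vec_of_nat_in_real_span)
      (simp add: lattice_optimal_solution_iff lattice_feasible_def)
  moreover have "v - vec_of_nat z \<in> real_span L"
    using v(1) by (simp add: relaxation_feasible_def)
  ultimately have "(v - vec_of_nat z) - (vec_of_nat y - vec_of_nat z) \<in> real_span L"
    unfolding real_span_def using span_diff by blast
  moreover have "w - vec_of_nat u = (v - vec_of_nat z) - (vec_of_nat y - vec_of_nat z)"
    by (simp add: w_def)
  ultimately have "w - vec_of_nat u \<in> real_span L"
    by simp
  moreover have "0 \<le> w $ i" if "i \<in> \<tau>" for i
    using v(1) y(2) that by (simp add: w_def relaxation_feasible_def lower_box_def vec_of_nat_def)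
  ultimately have "w \<in> gap_feasible L u \<tau>"
    by (simp add: gap_feasible_def)
  then have "c \<bullet> v' \<le> c \<bullet> w"
    using v'(2) by blast
  then show ?thesis
    by (simp add: v(2) v'(1) w_def inner_add_right inner_diff_right)
qed

text \<open>An optimal solution \<open>v\<close> of the program with fewer sign constraints violates the other
  constraints by a bounded amount only. Raising \<open>u\<close> by that amount outside \<open>\<tau>\<close> stays in the box,
  and there the translate of \<open>v\<close> satisfies all sign constraints.\<close>

lemma gap_value_in_gap_set:
  assumes box: "lower_box u \<tau> \<subseteq> optimal_points" and u: "\<forall>j. j \<notin> \<tau> \<longrightarrow> u $ j = 0"
  shows "gap_value L c u \<tau> \<in> gap_set L c"
proof -
  obtain v where v: "v \<in> gap_feasible L u \<tau>"
    "gap_value L c u \<tau> = ereal (c \<bullet> vec_of_nat u - c \<bullet> v)"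
    using gap_value_attained[OF box u] by blast
  define w :: "nat ^ 'n" where "w = (\<chi> i. if i \<in> \<tau> then u $ i else nat \<lceil>\<bar>v $ i\<bar>\<rceil>)"
  have w: "w \<in> lower_box u \<tau>"
    by (simp add: lower_box_def w_def)
  then have "lattice_optimal_solution L c w w"
    using box by (auto simp: optimal_points_def)
  then obtain x where x: "x \<in> relaxation_feasible L w"
    "lattice_optimum L c w - relaxation_optimum L c w = ereal (c \<bullet> vec_of_nat w - c \<bullet> x)"
    "\<forall>y\<in>relaxation_feasible L w. c \<bullet> x \<le> c \<bullet> y"
    using program_gap_eq by blast
  define y where "y = v + (vec_of_nat w - vec_of_nat u)"
  have "0 \<le> y $ i" for i
  proof (cases "i \<in> \<tau>")
    case True
    then show ?thesis
      using v(1) by (simp add: y_def w_def vec_of_nat_def gap_feasible_def)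
  next
    case False
    then have "y $ i = v $ i + real (nat \<lceil>\<bar>v $ i\<bar>\<rceil>)"
      using u by (simp add: y_def w_def vec_of_nat_def)
    then show ?thesis
      using real_nat_ceiling_ge[of "\<bar>v $ i\<bar>"] by linarith
  qed
  moreover have "y - vec_of_nat w \<in> real_span L"
    using v(1) by (simp add: y_def gap_feasible_def)
  ultimately have "y \<in> relaxation_feasible L w"
    by (simp add: relaxation_feasible_def)
  then have "c \<bullet> x \<le> c \<bullet> y"
    using x(3) by blast
  then have "gap_value L c u \<tau> \<le> lattice_optimum L c w - relaxation_optimum L c w"
    by (simp add: x(2) v(2) y_def inner_add_right inner_diff_right)
  moreover have "lattice_optimum L c w - relaxation_optimum L c w \<le> gap_value L c u \<tau>"
    using \<open>lattice_optimal_solution L c w w\<close> w by (rule program_gap_le_gap_value[OF box u])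
  ultimately have "gap_value L c u \<tau> = lattice_optimum L c w - relaxation_optimum L c w"
    by (rule antisym)
  then show ?thesis
    by (simp add: gap_set_def)
qed

end

section \<open>The gap as a maximum over irreducible components\<close>

theorem theorem2p1:
  fixes L :: "(int ^ 'n) set" and c :: "real ^ 'n" and m :: nat
  assumes "is_lattice L"
    and "lattice_rank L = m"
    and "\<forall>i. c $ i \<in> \<rat>"
    and "lattice_programs_bounded L c"
  shows "is_maximum (gap_set L c) (lattice_gap L c) \<and> \<bar>lattice_gap L c\<bar> \<noteq> \<infinity> \<and>
    is_maximum
      {gap_value L c u \<tau> | u \<tau>. (\<forall>j. j \<notin> \<tau> \<longrightarrow> u $ j = 0) \<and>
         component_ideal u \<tau> \<in> irreducible_components (nonoptimal_ideal L c)}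
      (lattice_gap L c)"
proof -
  interpret bounded_lattice_programs L c
    by unfold_locales (use assms in auto)
  define C where "C = irreducible_components (nonoptimal_ideal L c)"
  have "irredundant_decomposition (polys_avoiding optimal_points) C"
    unfolding C_def nonoptimal_ideal_eq
    using optimal_points_down_closed by (rule irreducible_components_polys_avoiding)
  then have C: "finite C" "\<And>J. J \<in> C \<Longrightarrow> irreducible_monomial_ideal J"
    "\<Inter>C = polys_avoiding optimal_points"
    by (auto simp: irredundant_decomposition_def)
  have box: "lower_box u \<tau> \<subseteq> optimal_points" if "component_ideal u \<tau> \<in> C" for u \<tau>
    using C(3) that by (auto simp: component_ideal_eq simp flip: polys_avoiding_subset_iff)
  obtain u \<tau> where component: "\<And>J j. J \<in> C \<Longrightarrow> j \<notin> \<tau> J \<Longrightarrow> u J $ j = 0"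
    "\<And>J. J \<in> C \<Longrightarrow> J = component_ideal (u J) (\<tau> J)"
    using irreducible_monomial_ideal_is_component_ideal C(2) by metis
  define V where "V = (\<lambda>J. gap_value L c (u J) (\<tau> J)) ` C"
  have upper: "\<exists>b\<in>V. g \<le> b" if g: "g \<in> gap_set L c" for g
  proof -
    obtain z where z: "g = lattice_optimum L c z - relaxation_optimum L c z"
      using g by (auto simp: gap_set_def)
    obtain y where y: "lattice_optimal_solution L c z y"
      using lattice_optimal_solution_exists by blast
    then have "monomial y \<notin> \<Inter>C"
      using lattice_optimal_solution_in_optimal_points
      by (simp add: C(3) monomial_in_polys_avoiding_iff)
    then obtain J where J: "J \<in> C" "monomial y \<notin> J"
      by blast
    have J_eq: "J = component_ideal (u J) (\<tau> J)"
      using component(2) J(1) .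
    have "y \<in> lower_box (u J) (\<tau> J)"
      using J(2) by (subst (asm) J_eq)
        (simp add: component_ideal_eq monomial_in_polys_avoiding_iff)
    moreover have "component_ideal (u J) (\<tau> J) \<in> C"
      using J(1) J_eq by simp
    ultimately have "g \<le> gap_value L c (u J) (\<tau> J)"
      unfolding z using component(1)[OF J(1)] y by (intro program_gap_le_gap_value box) auto
    then show ?thesis
      using J(1) by (auto simp: V_def)
  qed
  have attained: "gap_value L c u' \<tau>' \<in> gap_set L c"
    if "\<forall>j. j \<notin> \<tau>' \<longrightarrow> u' $ j = 0" "component_ideal u' \<tau>' \<in> C" for u' \<tau>'
    using that by (intro gap_value_in_gap_set box)
  have "finite V"
    by (simp add: V_def C(1))
  have "V \<noteq> {}"
    using upper by (auto simp: gap_set_def)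
  have "Max V \<in> V"
    using \<open>finite V\<close> \<open>V \<noteq> {}\<close> by (rule Max_in)
  then obtain J where J: "J \<in> C" "Max V = gap_value L c (u J) (\<tau> J)"
    by (auto simp: V_def)
  have u_J: "\<forall>j. j \<notin> \<tau> J \<longrightarrow> u J $ j = 0" "component_ideal (u J) (\<tau> J) \<in> C"
    using component(1)[OF J(1)] component(2)[OF J(1)] J(1) by auto
  have in_gap_set: "Max V \<in> gap_set L c"
    unfolding J(2) by (rule attained[OF u_J])
  have above: "g \<le> Max V" if "g \<in> gap_set L c" for g
    using upper[OF that] \<open>finite V\<close> by (auto intro: Max_ge order.trans)
  have gap: "lattice_gap L c = Max V"
    unfolding lattice_gap_def using in_gap_set above by (intro antisym Sup_least Sup_upper)
  have "\<exists>r. Max V = ereal r"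
    using gap_value_attained[OF box[OF u_J(2)] u_J(1)] by (auto simp: J(2))
  then have "\<bar>lattice_gap L c\<bar> \<noteq> \<infinity>"
    by (auto simp: gap)
  moreover have "is_maximum (gap_set L c) (lattice_gap L c)"
    using in_gap_set above by (simp add: is_maximum_def gap)
  moreover have "is_maximum {gap_value L c u \<tau> | u \<tau>.
      (\<forall>j. j \<notin> \<tau> \<longrightarrow> u $ j = 0) \<and> component_ideal u \<tau> \<in> C} (lattice_gap L c)"
    using u_J J(2) attained above unfolding is_maximum_def gap by blast
  ultimately show ?thesis
    by (simp add: C_def)
qed

end
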